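(* Let $m,n\in\mathbb{N}$, let $0<p\le 1$, and let $\Phi: M_m(\mathbb{C})\to M_n(\mathbb{C})$ be a unital Schwarz map. Then for any $A\in M_n^{++}(\mathbb{C})$ and any $B\in M_m(\mathbb{C})$, $$\operatorname{Tr}\left[\left(\Phi(B)^*A^p\,\Phi(B)\right)^{1/p}\right]\le \operatorname{Tr}\left[\left(B^*\Phi^\dagger(A)^pB\right)^{1/p}\right].$$
   Context: $M_n(\mathbb{C})$ denotes the $n\times n$ complex matrices and $M_n^{++}(\mathbb{C})$ the open cone of positive definite matrices in $M_n(\mathbb{C})$; $\mathbf{1}$ is the identity matrix. Each $M_n(\mathbb{C})$ carries the Hilbert–Schmidt inner product $\langle X,Y\rangle=\operatorname{Tr}[X^*Y]$, and $\Phi^\dagger: M_n(\mathbb{C})\to M_m(\mathbb{C})$ is the adjoint of $\Phi$ with respect to these inner products. A Schwarz map is a linear map $\Phi: M_m(\mathbb{C})\to M_n(\mathbb{C})$ such that $\Phi(X^*X)\ge \Phi(X)^*\Phi(X)$ for all $X\in M_m(\mathbb{C})$. $\Phi$ is unital if $\Phi(\mathbf{1})=\mathbf{1}$. *)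

theory Defs
  imports "HOL-Analysis.Analysis"
begin

text \<open>
  The type \<open>complex^'n^'n\<close> plays the role of \<open>M_n(C)\<close> with \<open>n = CARD('n)\<close>.
  The order on \<open>complex\<close> is the one of \<open>HOL-Library.Complex_Order\<close>: \<open>x \<le> y\<close> requires
  \<open>Im x = Im y\<close>.  The library order on \<open>vec\<close> types is componentwise and hence is
  not the Loewner order; it is not used here.
\<close>

definition cadj :: "complex^'n^'m \<Rightarrow> complex^'m^'n" where
  "cadj A = map_matrix cnj (transpose A)"

definition quad_form :: "complex^'n^'n \<Rightarrow> complex^'n \<Rightarrow> complex" where
  "quad_form A x = (\<Sum>i\<in>UNIV. cnj (x $ i) * (A *v x) $ i)"

definition pos_semidef :: "complex^'n^'n \<Rightarrow> bool" where
  "pos_semidef A \<longleftrightarrow> cadj A = A \<and> (\<forall>x. 0 \<le> quad_form A x)"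

definition pos_def :: "complex^'n^'n \<Rightarrow> bool" where
  "pos_def A \<longleftrightarrow> cadj A = A \<and> (\<forall>x. x \<noteq> 0 \<longrightarrow> 0 < quad_form A x)"

definition loewner_le :: "complex^'n^'n \<Rightarrow> complex^'n^'n \<Rightarrow> bool" where
  "loewner_le A B \<longleftrightarrow> pos_semidef (B - A)"

definition cscale :: "complex \<Rightarrow> complex^'n^'m \<Rightarrow> complex^'n^'m" where
  "cscale c A = (\<chi> i. c *s (A $ i))"

lemma vector_space_cscale: "vector_space cscale"
  by unfold_locales (auto simp: cscale_def vec_eq_iff algebra_simps)

text \<open>\<open>Vector_Spaces.linear\<close> over \<open>cscale\<close> is linearity over \<open>complex\<close>, whereas
  \<open>linear\<close> would only be linearity over \<open>real\<close>.\<close>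

definition schwarz_map :: "(complex^'m^'m \<Rightarrow> complex^'n^'n) \<Rightarrow> bool" where
  "schwarz_map \<Phi> \<longleftrightarrow>
     Vector_Spaces.linear cscale cscale \<Phi> \<and>
     (\<forall>X. loewner_le (cadj (\<Phi> X) ** \<Phi> X) (\<Phi> (cadj X ** X)))"

definition unital :: "(complex^'m^'m \<Rightarrow> complex^'n^'n) \<Rightarrow> bool" where
  "unital \<Phi> \<longleftrightarrow> \<Phi> (mat 1) = mat 1"

definition hs_inner :: "complex^'n^'n \<Rightarrow> complex^'n^'n \<Rightarrow> complex" where
  "hs_inner X Y = trace (cadj X ** Y)"

definition hs_adjoint ::
    "(complex^'m^'m \<Rightarrow> complex^'n^'n) \<Rightarrow> complex^'n^'n \<Rightarrow> complex^'m^'m" where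
  "hs_adjoint \<Phi> = (THE \<Psi>. \<forall>X Y. hs_inner (\<Phi> X) Y = hs_inner X (\<Psi> Y))"

definition unitary_mat :: "complex^'n^'n \<Rightarrow> bool" where
  "unitary_mat U \<longleftrightarrow> cadj U ** U = mat 1 \<and> U ** cadj U = mat 1"

definition diag_mat :: "('n \<Rightarrow> real) \<Rightarrow> complex^'n^'n" where
  "diag_mat d = (\<chi> i j. if i = j then complex_of_real (d i) else 0)"

text \<open>Functional calculus for Hermitian matrices.  The value does not depend on the
  diagonalization (lemma \<open>is_mat_fun_unique\<close>); one exists exactly when \<open>A\<close> is Hermitian.\<close>

definition is_mat_fun ::
    "(real \<Rightarrow> real) \<Rightarrow> complex^'n^'n \<Rightarrow> complex^'n^'n \<Rightarrow> bool" where
  "is_mat_fun f A M \<longleftrightarrow>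
     (\<exists>U d. unitary_mat U \<and> A = U ** diag_mat d ** cadj U \<and>
            M = U ** diag_mat (\<lambda>i. f (d i)) ** cadj U)"

definition mat_fun :: "(real \<Rightarrow> real) \<Rightarrow> complex^'n^'n \<Rightarrow> complex^'n^'n" where
  "mat_fun f A = (THE M. is_mat_fun f A M)"

text \<open>For positive semidefinite \<open>A\<close> and \<open>r > 0\<close> this is the usual power \<open>A\<^sup>r\<close>, with
  \<open>0 powr r = 0\<close> on the kernel of \<open>A\<close>.\<close>

definition mat_powr :: "complex^'n^'n \<Rightarrow> real \<Rightarrow> complex^'n^'n" where
  "mat_powr A r = mat_fun (\<lambda>t. t powr r) A"

lemma diag_mat_mult_right: "(V ** diag_mat d) $ i $ j = V $ i $ j * complex_of_real (d j)"
proof -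
  have "(V ** diag_mat d) $ i $ j =
      (\<Sum>k\<in>UNIV. if k = j then V $ i $ j * complex_of_real (d j) else 0)"
    unfolding matrix_matrix_mult_def diag_mat_def vec_lambda_beta by (rule sum.cong) auto
  then show ?thesis by simp
qed

lemma diag_mat_mult_left: "(diag_mat d ** V) $ i $ j = complex_of_real (d i) * V $ i $ j"
proof -
  have "(diag_mat d ** V) $ i $ j =
      (\<Sum>k\<in>UNIV. if k = i then complex_of_real (d i) * V $ i $ j else 0)"
    unfolding matrix_matrix_mult_def diag_mat_def vec_lambda_beta by (rule sum.cong) auto
  then show ?thesis by simp
qed

lemma is_mat_fun_unique:
  assumes "is_mat_fun f A M" "is_mat_fun f A N"
  shows "M = N"
proof -
  obtain U d where U: "unitary_mat U" "A = U ** diag_mat d ** cadj U"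
      "M = U ** diag_mat (\<lambda>i. f (d i)) ** cadj U"
    using assms(1) unfolding is_mat_fun_def by blast
  obtain W e where W: "unitary_mat W" "A = W ** diag_mat e ** cadj W"
      "N = W ** diag_mat (\<lambda>i. f (e i)) ** cadj W"
    using assms(2) unfolding is_mat_fun_def by blast
  define V where "V = cadj W ** U"
  have UU: "cadj U ** U = mat 1" "U ** cadj U = mat 1"
    and WW: "cadj W ** W = mat 1" "W ** cadj W = mat 1"
    using U(1) W(1) by (auto simp: unitary_mat_def)
  have c1: "cadj W ** (U ** D ** cadj U) ** U = V ** D" for D
    by (metis V_def UU(1) matrix_mul_assoc matrix_mul_rid)
  have c2: "cadj W ** (W ** D ** cadj W) ** U = D ** V" for D
    by (metis V_def WW(1) matrix_mul_assoc matrix_mul_lid)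
  have "V ** diag_mat d = diag_mat e ** V"
    using c1[of "diag_mat d"] c2[of "diag_mat e"] U(2) W(2) by simp
  then have "V $ i $ j * complex_of_real (d j) = complex_of_real (e i) * V $ i $ j" for i j
    by (metis diag_mat_mult_left diag_mat_mult_right)
  then have "V $ i $ j = 0 \<or> d j = e i" for i j
    by (metis mult.commute mult_cancel_left of_real_eq_iff)
  then have "V $ i $ j * complex_of_real (f (d j)) =
      complex_of_real (f (e i)) * V $ i $ j" for i j
    by (metis mult.commute mult_zero_left)
  then have "V ** diag_mat (\<lambda>i. f (d i)) = diag_mat (\<lambda>i. f (e i)) ** V"
    by (simp add: vec_eq_iff diag_mat_mult_left diag_mat_mult_right)
  then have "cadj W ** M ** U = cadj W ** N ** U"
    using c1 c2 U(3) W(3) by metis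
  then show ?thesis
    by (metis UU(2) WW(2) matrix_mul_assoc matrix_mul_lid matrix_mul_rid)
qed

lemma mat_fun_eq: "is_mat_fun f A M \<Longrightarrow> mat_fun f A = M"
  unfolding mat_fun_def by (blast intro: is_mat_fun_unique)

lemma hs_inner_eq: "hs_inner X Y = (\<Sum>i\<in>UNIV. \<Sum>j\<in>UNIV. cnj (X $ i $ j) * Y $ i $ j)"
proof -
  have "hs_inner X Y = (\<Sum>j\<in>UNIV. \<Sum>i\<in>UNIV. cnj (X $ i $ j) * Y $ i $ j)"
    by (simp add: hs_inner_def trace_def matrix_matrix_mult_def cadj_def transpose_def)
  then show ?thesis by (subst sum.swap)
qed

lemma hs_adjoint_works:
  assumes "Vector_Spaces.linear cscale cscale \<Phi>"
  shows "hs_inner (\<Phi> X) Y = hs_inner X (hs_adjoint \<Phi> Y)"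
proof -
  interpret L: Vector_Spaces.linear cscale cscale \<Phi> by fact
  define E :: "'a \<Rightarrow> 'a \<Rightarrow> complex^'a^'a" where
    "E a b = (\<chi> i j. if i = a \<and> j = b then 1 else 0)" for a b
  define \<Psi> where "\<Psi> Y = (\<chi> i j. hs_inner (\<Phi> (E i j)) Y)" for Y
  have exp: "X = (\<Sum>a\<in>UNIV. \<Sum>b\<in>UNIV. cscale (X $ a $ b) (E a b))" for X :: "complex^'a^'a"
  proof -
    have "(\<Sum>a\<in>UNIV. \<Sum>b\<in>UNIV. cscale (X $ a $ b) (E a b)) $ i $ j = X $ i $ j" for i j
    proof -
      have "(\<Sum>a\<in>UNIV. \<Sum>b\<in>UNIV. cscale (X $ a $ b) (E a b)) $ i $ j
        = (\<Sum>a\<in>UNIV. \<Sum>b\<in>UNIV. if b = j then (if a = i then X $ i $ j else 0) else 0)"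
        unfolding sum_component by (intro sum.cong refl) (auto simp: cscale_def E_def)
      then show ?thesis by simp
    qed
    then show ?thesis by (simp add: vec_eq_iff)
  qed
  have add: "hs_inner (sum g S) Y = (\<Sum>s\<in>S. hs_inner (g s) Y)" if "finite S"
    for g :: "'a \<Rightarrow> complex^'b^'b" and S Y
    using that by induction (simp_all add: hs_inner_eq sum.distrib algebra_simps)
  have sc: "hs_inner (cscale c Z) Y = cnj c * hs_inner Z Y" for c and Z Y :: "complex^'b^'b"
    by (simp add: hs_inner_eq cscale_def sum_distrib_left mult.assoc)
  have ex: "hs_inner (\<Phi> X) Y = hs_inner X (\<Psi> Y)" for X Y
  proof -
    have "hs_inner (\<Phi> X) Y =
      hs_inner (\<Sum>a\<in>UNIV. \<Sum>b\<in>UNIV. cscale (X $ a $ b) (\<Phi> (E a b))) Y"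
      by (subst exp[of X]) (simp add: L.sum L.scale)
    also have "\<dots> = hs_inner X (\<Psi> Y)"
      by (simp add: add sc) (simp add: hs_inner_eq[of X] \<Psi>_def)
    finally show ?thesis .
  qed
  have "\<Psi>' = \<Psi>" if "\<forall>X Y. hs_inner (\<Phi> X) Y = hs_inner X (\<Psi>' Y)" for \<Psi>'
  proof
    fix Y
    have unit: "hs_inner (E a b) Z = Z $ a $ b" for a b Z
    proof -
      have "hs_inner (E a b) Z =
        (\<Sum>i\<in>UNIV. \<Sum>j\<in>UNIV. if j = b then (if i = a then Z $ a $ b else 0) else 0)"
        unfolding hs_inner_eq E_def by (intro sum.cong refl) auto
      then show ?thesis by simp
    qed
    have "\<Psi>' Y $ a $ b = \<Psi> Y $ a $ b" for a b
      using that ex unit by metis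
    then show "\<Psi>' Y = \<Psi> Y" by (simp add: vec_eq_iff)
  qed
  then have "hs_adjoint \<Phi> = \<Psi>"
    unfolding hs_adjoint_def using ex by (intro the_equality) blast+
  then show ?thesis using ex by simp
qed

end

theory Submission
  imports Defs
begin

text \<open>
  Write \<open>\<Psi>\<close> for the Hilbert--Schmidt adjoint of \<open>\<Phi>\<close>, \<open>M = \<Phi>(B)\<^sup>* A\<^sup>p \<Phi>(B)\<close> and
  \<open>N = B\<^sup>* \<Psi>(A)\<^sup>p B\<close>.  For \<open>p = 1\<close> the claim is the Schwarz inequality for \<open>B\<^sup>*\<close> paired with
  \<open>A\<close> under the trace.  For \<open>p < 1\<close> put \<open>C = M\<^bsup>1/p\<^esup>\<close>, so that \<open>M C\<^bsup>1-p\<^esup> = C\<close>.  Then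
  \<open>Tr C = Tr (M C\<^bsup>1-p\<^esup>) \<le> Tr (N \<Psi>(C)\<^bsup>1-p\<^esup>) \<le> p Tr N\<^bsup>1/p\<^esup> + (1 - p) Tr \<Psi>(C)\<close>,
  and \<open>Tr \<Psi>(C) = Tr C\<close> because \<open>\<Phi>\<close> is unital; cancelling \<open>(1 - p) Tr C\<close> leaves
  \<open>p Tr C \<le> p Tr N\<^bsup>1/p\<^esup>\<close>, which is the claim.

  The second inequality (lemma \<open>trace_mult_powr_le\<close>) is Young's scalar inequality between
  eigenvalues, averaged against the squared moduli of the entries of the unitary matrix that
  links the two eigenbases; these form a doubly stochastic matrix.

  The first one is Uhlmann's monotonicity of Lieb's functional
  \<open>Tr (K\<^sup>* A\<^sup>s K C\<^bsup>1-s\<^esup>)\<close> (lemma \<open>lieb_functional_monotone\<close>).  At the end points \<open>s = 1\<close> and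
  \<open>s = 0\<close> it is the Schwarz inequality.  In between one interpolates with the parallel sum
  \<open>x : y = x y / (x + y)\<close>.  On the one hand, for fixed \<open>K\<close>, the form obtained from the
  numbers \<open>t a : c\<close> is the minimum of \<open>t Tr (K\<^sub>1\<^sup>* A K\<^sub>1) + Tr (K\<^sub>2\<^sup>* K\<^sub>2 C)\<close> over all
  splittings \<open>K = K\<^sub>1 + K\<^sub>2\<close>; since \<open>\<Phi>\<close> maps splittings of \<open>K\<close> to splittings of \<open>\<Phi>(K)\<close>, it
  inherits the end point inequalities.  On the other hand, \<open>a\<^sup>s c\<^bsup>1-s\<^esup>\<close> is, up to a positive
  constant, the integral of \<open>t\<^bsup>-s-1\<^esup> (t a : c)\<close> over \<open>t > 0\<close>, so the inequality for all
  \<open>t\<close> integrates to the one for \<open>s\<close>.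

  In eigenbases of \<open>A\<close> and \<open>C\<close> all forms involved are diagonal in the matrix entries of \<open>K\<close>,
  which reduces the whole interpolation to real numbers.  This rests on the spectral theorem for
  Hermitian matrices, proved here by maximizing the quadratic form on the orthogonal complement
  of the eigenvectors found so far.
\<close>

section \<open>Matrix algebra and adjoints\<close>

lemma cadj_component [simp]: "cadj A $ i $ j = cnj (A $ j $ i)"
  by (simp add: cadj_def transpose_def map_matrix_def)

lemma cadj_cadj [simp]: "cadj (cadj A) = A"
  by (simp add: vec_eq_iff)

lemma cadj_mat_1 [simp]: "cadj (mat 1 :: complex^'n^'n) = mat 1"
  by (simp add: vec_eq_iff mat_def)

lemma cadj_diag_mat [simp]: "cadj (diag_mat d) = diag_mat d"
  by (simp add: vec_eq_iff diag_mat_def)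

lemma cadj_add: "cadj (A + B) = cadj A + cadj B"
  by (simp add: vec_eq_iff)

lemma cadj_diff: "cadj (A - B) = cadj A - cadj B"
  by (simp add: vec_eq_iff)

lemma cadj_cscale: "cadj (cscale c A) = cscale (cnj c) (cadj A)"
  by (simp add: vec_eq_iff cscale_def)

lemma cadj_mult: "cadj (A ** B) = cadj B ** cadj A"
  by (simp add: vec_eq_iff matrix_matrix_mult_def mult.commute)

lemma trace_cadj: "trace (cadj A) = cnj (trace A)"
  by (simp add: trace_def)

lemma trace_cyclic: "trace (A ** B ** C) = trace (C ** A ** B)"
  for A B C :: "complex^'n^'n"
  by (metis trace_mul_sym matrix_mul_assoc)

lemma matrix_add_rdistrib: "(B + C) ** A = B ** A + C ** A"
  for A B C :: "complex^'n^'n"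
  by (simp add: vec_eq_iff matrix_matrix_mult_def algebra_simps sum.distrib)

lemma matrix_diff_ldistrib: "A ** (B - C) = A ** B - A ** C"
  for A B C :: "complex^'n^'n"
  by (simp add: vec_eq_iff matrix_matrix_mult_def algebra_simps sum_subtractf)

lemma matrix_diff_rdistrib: "(B - C) ** A = B ** A - C ** A"
  for A B C :: "complex^'n^'n"
  by (simp add: vec_eq_iff matrix_matrix_mult_def algebra_simps sum_subtractf)

lemma cscale_mat_1_mult: "cscale a (mat 1) ** Z = cscale a Z"
  for Z :: "complex^'n^'n"
proof -
  have "(cscale a (mat 1) ** Z) $ i $ j = (\<Sum>k\<in>UNIV. if k = i then a * Z $ i $ j else 0)" for i j
    unfolding matrix_matrix_mult_def vec_lambda_beta cscale_def mat_def
    by (intro sum.cong) auto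
  then show ?thesis by (simp add: vec_eq_iff cscale_def)
qed

lemma mult_cscale_mat_1: "Z ** cscale a (mat 1) = cscale a Z"
  for Z :: "complex^'n^'n"
proof -
  have "(Z ** cscale a (mat 1)) $ i $ j = (\<Sum>k\<in>UNIV. if k = j then a * Z $ i $ j else 0)" for i j
    unfolding matrix_matrix_mult_def vec_lambda_beta cscale_def mat_def
    by (intro sum.cong) auto
  then show ?thesis by (simp add: vec_eq_iff cscale_def)
qed

section \<open>Spectral theorem for Hermitian matrices\<close>

text \<open>
  The real inner product of \<open>complex^'n\<close> is the real part of the Hermitian one, so a Hermitian
  matrix is self-adjoint for it.  This makes the real Euclidean theory of compactness, subspaces
  and dimension applicable to complex matrices.
\<close>

lemma inner_cadj: "x \<bullet> (A *v y) = (cadj A *v x) \<bullet> y" for A :: "complex^'n^'m"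
proof -
  have "x \<bullet> (A *v y) = (\<Sum>i\<in>UNIV. \<Sum>j\<in>UNIV. Re (x $ i * cnj (A $ i $ j * y $ j)))"
    by (simp add: inner_vec_def matrix_vector_mult_def inner_complex_def sum_distrib_left
        sum_distrib_right algebra_simps sum.distrib sum_subtractf)
  also have "\<dots> = (\<Sum>j\<in>UNIV. \<Sum>i\<in>UNIV. Re (x $ i * cnj (A $ i $ j * y $ j)))"
    by (rule sum.swap)
  also have "\<dots> = (cadj A *v x) \<bullet> y"
    by (simp add: inner_vec_def matrix_vector_mult_def inner_complex_def sum_distrib_left
        sum_distrib_right algebra_simps sum.distrib sum_subtractf)
  finally show ?thesis .
qed

text \<open>
  A quadratic form that is nonnegative on \<open>T\<close> and vanishes at \<open>v\<close> has a minimum at \<open>v\<close>, so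
  its derivative there vanishes in every direction of \<open>T\<close>.
\<close>

lemma psd_form_zero_imp_orthogonal:
  fixes L :: "'a::real_inner \<Rightarrow> 'a"
  assumes "linear L" and sa: "\<And>x y. x \<in> T \<Longrightarrow> y \<in> T \<Longrightarrow> x \<bullet> L y = L x \<bullet> y"
    and T: "subspace T" and nn: "\<And>x. x \<in> T \<Longrightarrow> 0 \<le> x \<bullet> L x"
    and v: "v \<in> T" "v \<bullet> L v = 0" and y: "y \<in> T"
  shows "y \<bullet> L v = 0"
proof (rule ccontr)
  interpret L: linear L by fact
  assume ne: "y \<bullet> L v \<noteq> 0"
  define b where "b = y \<bullet> L v"
  define q where "q = y \<bullet> L y"
  have q: "q \<ge> 0" using nn[OF y] by (simp add: q_def)
  have *: "0 \<le> 2 * t * b + t * t * q" for t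
  proof -
    have "v + t *\<^sub>R y \<in> T" using T v y by (simp add: subspace_add subspace_scale)
    from nn[OF this] have "0 \<le> (v + t *\<^sub>R y) \<bullet> L (v + t *\<^sub>R y)" .
    also have "\<dots> = 2 * t * b + t * t * q"
      using sa[OF v(1) y] v(2) unfolding b_def q_def
      by (simp add: L.add L.scale inner_add_left inner_add_right algebra_simps inner_commute)
    finally show ?thesis .
  qed
  \<comment> \<open>At \<open>t = - b / (q + 1)\<close> the nonnegative polynomial \<open>2 t b + t\<^sup>2 q\<close> would be negative;
    the shift by one covers the case \<open>q = 0\<close>.\<close>
  have "2 * (- b / (q + 1)) * b + (- b / (q + 1)) * (- b / (q + 1)) * q
      = - (b\<^sup>2 * (q + 2) / (q + 1)\<^sup>2)"
    using q by (simp add: divide_simps) (simp add: algebra_simps power2_eq_square)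
  moreover have "b\<^sup>2 * (q + 2) / (q + 1)\<^sup>2 > 0"
    using ne q unfolding b_def by (intro divide_pos_pos mult_pos_pos) auto
  ultimately show False using *[of "- b / (q + 1)"] by linarith
qed

text \<open>
  A maximizer \<open>v\<close> of \<open>x \<bullet> L x\<close> on the unit sphere of \<open>T\<close>, with maximum \<open>l\<close>, is an
  eigenvector: the form of \<open>G = l - L\<close> is nonnegative on \<open>T\<close> and vanishes at \<open>v\<close>, so \<open>G v\<close> is
  orthogonal to \<open>T\<close>, but by invariance it also lies in \<open>T\<close>.
\<close>

lemma selfadjoint_eigenvector_on_invariant_subspace:
  fixes L :: "'a::euclidean_space \<Rightarrow> 'a"
  assumes L: "linear L" and sa: "\<And>x y. x \<in> T \<Longrightarrow> y \<in> T \<Longrightarrow> x \<bullet> L y = L x \<bullet> y"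
    and T: "subspace T" and inv: "\<And>x. x \<in> T \<Longrightarrow> L x \<in> T" and nz: "z \<in> T" "z \<noteq> 0"
  obtains v l where "v \<in> T" "norm v = 1" "L v = l *\<^sub>R v"
proof -
  interpret L: linear L by fact
  let ?S = "sphere 0 1 \<inter> T"
  have "compact ?S" using T by (simp add: closed_subspace compact_Int_closed)
  moreover have "z /\<^sub>R norm z \<in> ?S" using nz T by (simp add: subspace_scale)
  then have "?S \<noteq> {}" by blast
  moreover have "continuous_on ?S (\<lambda>x. x \<bullet> L x)"
    using L by (intro continuous_intros linear_continuous_on linear_linear[THEN iffD2])
      (simp add: linear_conv_bounded_linear)
  ultimately obtain v where v: "v \<in> ?S" and max: "\<And>x. x \<in> ?S \<Longrightarrow> x \<bullet> L x \<le> v \<bullet> L v"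
    by (metis continuous_attains_sup)
  define l where "l = v \<bullet> L v"
  define G where "G x = l *\<^sub>R x - L x" for x
  have G: "linear G" unfolding G_def
    by (intro linear_compose_sub L linear_scaleR)
  have vv: "v \<bullet> v = 1" using v by (simp add: dot_square_norm)
  have nn: "0 \<le> x \<bullet> G x" if "x \<in> T" for x
  proof (cases "x = 0")
    case False
    have "(x /\<^sub>R norm x) \<in> ?S" using that False T by (simp add: subspace_scale)
    from max[OF this] have "(x \<bullet> L x) / (norm x * norm x) \<le> l"
      by (simp add: L.scale l_def field_simps)
    then have "x \<bullet> L x \<le> l * (x \<bullet> x)"
      using False by (simp add: field_simps dot_square_norm power2_eq_square)
    then show ?thesis by (simp add: G_def inner_diff_right)
  qed (simp add: G_def)
  have "G v \<bullet> G v = 0"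
  proof (rule psd_form_zero_imp_orthogonal[OF G _ T nn])
    show "x \<bullet> G y = G x \<bullet> y" if "x \<in> T" "y \<in> T" for x y
      using sa[OF that] by (simp add: G_def inner_diff_left inner_diff_right)
    show "v \<bullet> G v = 0" using vv by (simp add: G_def inner_diff_right l_def)
    show "v \<in> T" using v by simp
    show "G v \<in> T" using v inv T by (simp add: G_def subspace_diff subspace_scale)
  qed
  then have "L v = l *\<^sub>R v" by (simp add: G_def)
  with v that show ?thesis by auto
qed

definition herm_dot :: "complex^'n \<Rightarrow> complex^'n \<Rightarrow> complex" where
  "herm_dot x y = (\<Sum>i\<in>UNIV. cnj (x $ i) * y $ i)"

lemma Re_herm_dot: "Re (herm_dot x y) = x \<bullet> y"
  by (simp add: herm_dot_def inner_vec_def inner_complex_def)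

lemma Im_herm_dot: "Im (herm_dot x y) = (\<i> *s x) \<bullet> y"
  by (simp add: herm_dot_def inner_vec_def inner_complex_def)

lemma herm_dot_0_iff: "herm_dot x y = 0 \<longleftrightarrow> x \<bullet> y = 0 \<and> (\<i> *s x) \<bullet> y = 0"
  by (simp add: complex_eq_iff Re_herm_dot Im_herm_dot)

lemma herm_dot_self: "herm_dot x x = complex_of_real ((norm x)\<^sup>2)"
  by (simp add: complex_eq_iff Re_herm_dot Im_herm_dot dot_square_norm)
   (simp add: inner_vec_def inner_complex_def)

lemma herm_dot_commute: "herm_dot y x = cnj (herm_dot x y)"
  by (simp add: herm_dot_def mult.commute)

text \<open>
  Hermitian orthogonality to \<open>s\<close> is real orthogonality to both \<open>s\<close> and \<open>\<i> s\<close>, and the at most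
  \<open>2 card S\<close> vectors of this kind cannot span a space of real dimension \<open>2 CARD('n)\<close>.
\<close>

lemma exists_herm_orthogonal:
  fixes S :: "(complex^'n) set"
  assumes "finite S" "card S < CARD('n)"
  shows "\<exists>z. z \<noteq> 0 \<and> (\<forall>s\<in>S. herm_dot s z = 0)"
proof -
  let ?R = "S \<union> (\<lambda>s. \<i> *s s) ` S"
  have "card ?R \<le> 2 * card S"
    using card_Un_le[of S "(\<lambda>s. \<i> *s s) ` S"] card_image_le[OF assms(1), of "\<lambda>s. \<i> *s s"] by linarith
  then have "dim ?R \<le> 2 * card S" using dim_le_card'[of ?R] assms(1) by simp
  then have "dim ?R < DIM(complex^'n)" using assms(2) by simp
  then obtain z where "z \<noteq> 0" "\<And>y. y \<in> span ?R \<Longrightarrow> orthogonal z y"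
    using orthogonal_to_subspace_exists[of ?R] by metis
  then show ?thesis
    by (intro exI[of _ z]) (auto simp: herm_dot_0_iff span_base orthogonal_def inner_commute[of _ z])
qed

text \<open>
  The Hermitian orthogonal complement \<open>T\<close> of the eigenvectors found so far is invariant under
  \<open>A\<close>, and it contains a further eigenvector as long as it is nonzero.
\<close>

lemma hermitian_orthonormal_eigenvectors:
  fixes A :: "complex^'n^'n"
  assumes A: "cadj A = A" and "k \<le> CARD('n)"
  shows "\<exists>S. finite S \<and> card S = k \<and> (\<forall>s\<in>S. norm s = 1 \<and> (\<exists>l. A *v s = l *\<^sub>R s)) \<and>
           (\<forall>s\<in>S. \<forall>t\<in>S. s \<noteq> t \<longrightarrow> herm_dot s t = 0)"
  using assms(2)
proof (induction k)
  case 0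
  show ?case by (intro exI[of _ "{}"]) auto
next
  case (Suc k)
  then obtain S where S: "finite S" "card S = k" and
    eig: "\<And>s. s \<in> S \<Longrightarrow> norm s = 1 \<and> (\<exists>l. A *v s = l *\<^sub>R s)" and
    orth: "\<And>s t. s \<in> S \<Longrightarrow> t \<in> S \<Longrightarrow> s \<noteq> t \<Longrightarrow> herm_dot s t = 0"
    by auto
  define T where "T = {x. \<forall>s\<in>S. herm_dot s x = 0}"
  have sub: "subspace T"
    unfolding T_def subspace_def by (simp add: herm_dot_0_iff inner_add_right)
  have inv: "A *v x \<in> T" if "x \<in> T" for x
  proof -
    have "herm_dot s (A *v x) = 0" if s: "s \<in> S" for s
    proof -
      obtain l where l: "A *v s = l *\<^sub>R s" using eig[OF s] by blast
      have l': "A *v (\<i> *s s) = l *\<^sub>R (\<i> *s s)"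
        unfolding vector_scalar_commute l by (simp add: vec_eq_iff)
      show ?thesis using \<open>x \<in> T\<close> s
        unfolding herm_dot_0_iff inner_cadj A l l' by (simp add: T_def herm_dot_0_iff)
    qed
    then show ?thesis by (simp add: T_def)
  qed
  obtain z where z: "z \<in> T" "z \<noteq> 0"
    using exists_herm_orthogonal[OF S(1)] S(2) Suc.prems by (auto simp: T_def)
  have "linear (\<lambda>x. A *v x)" by (simp add: linear_matrix_vector_mul_eq)
  then obtain v l where v: "v \<in> T" "norm v = 1" "A *v v = l *\<^sub>R v"
    using selfadjoint_eigenvector_on_invariant_subspace[of "\<lambda>x. A *v x" T z] sub inv z
    by (metis inner_cadj A)
  have "v \<notin> S"
    using v(1,2) by (auto simp: T_def herm_dot_self)
  moreover have "\<forall>s\<in>S. herm_dot s v = 0 \<and> herm_dot v s = 0"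
    using v(1) herm_dot_commute[of v] by (simp add: T_def)
  moreover have "\<forall>s\<in>insert v S. norm s = 1 \<and> (\<exists>l. A *v s = l *\<^sub>R s)"
    using eig v(2,3) by blast
  ultimately show ?case
    using S orth by (intro exI[of _ "insert v S"]) auto
qed

theorem hermitian_spectral_decomposition:
  fixes A :: "complex^'n^'n"
  assumes "cadj A = A"
  obtains U d where "unitary_mat U" "A = U ** diag_mat d ** cadj U"
proof -
  obtain S :: "(complex^'n) set" where S: "finite S" "card S = CARD('n)" and
    eig: "\<And>s. s \<in> S \<Longrightarrow> norm s = 1 \<and> (\<exists>l. A *v s = l *\<^sub>R s)" and
    orth: "\<And>s t. s \<in> S \<Longrightarrow> t \<in> S \<Longrightarrow> s \<noteq> t \<Longrightarrow> herm_dot s t = 0"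
    using hermitian_orthonormal_eigenvectors[OF assms order_refl] by auto
  obtain e :: "'n \<Rightarrow> complex^'n" where e: "bij_betw e UNIV S"
    using S finite_same_card_bij[of "UNIV :: 'n set" S] by auto
  have eS: "e i \<in> S" for i using e by (auto simp: bij_betw_def)
  have "\<forall>i. \<exists>l. A *v e i = l *\<^sub>R e i" using eig eS by blast
  then have "\<exists>d. \<forall>i. A *v e i = d i *\<^sub>R e i" by (rule choice)
  then obtain d where d: "\<And>i. A *v e i = d i *\<^sub>R e i" by blast
  define U :: "complex^'n^'n" where "U = (\<chi> i j. e j $ i)"
  have "(cadj U ** U) $ i $ j = mat 1 $ i $ j" for i j
  proof -
    have "(cadj U ** U) $ i $ j = herm_dot (e i) (e j)"
      by (simp add: U_def matrix_matrix_mult_def herm_dot_def)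
    also have "\<dots> = mat 1 $ i $ j"
      using orth[OF eS eS, of i j] eig[OF eS, of i] e
      by (auto simp: mat_def herm_dot_self bij_betw_def inj_on_def)
    finally show ?thesis .
  qed
  then have U1: "cadj U ** U = mat 1" by (simp add: vec_eq_iff)
  then have U: "unitary_mat U" by (simp add: unitary_mat_def matrix_left_right_inverse)
  have "(A ** U) $ i $ j = (U ** diag_mat d) $ i $ j" for i j
  proof -
    have "(A ** U) $ i $ j = (A *v e j) $ i"
      by (simp add: U_def matrix_matrix_mult_def matrix_vector_mult_def)
    also have "\<dots> = (U ** diag_mat d) $ i $ j"
      unfolding d diag_mat_mult_right vector_scaleR_component
      by (simp add: U_def scaleR_conv_of_real mult.commute)
    finally show ?thesis .
  qed
  then have "A ** U = U ** diag_mat d" by (simp add: vec_eq_iff)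
  then have "A = U ** diag_mat d ** cadj U"
    using U by (metis matrix_mul_assoc matrix_mul_rid unitary_mat_def)
  with U that show ?thesis by blast
qed

section \<open>Traces in eigenbases\<close>

text \<open>
  In eigenbases of the two Hermitian factors the form \<open>X \<mapsto> Tr (X\<^sup>* F X G)\<close> is diagonal in
  the entries of the transformed matrix \<open>U\<^sup>* X V\<close>.  The double sum over matrix entries is written as
  one sum over pairs of indices, as the scalar inequalities below speak about single sums.
\<close>

lemma trace_weighted_sandwich:
  fixes X :: "complex^'n^'n"
  shows "trace (cadj X ** (U ** diag_mat f ** cadj U) ** X ** (V ** diag_mat g ** cadj V)) =
    complex_of_real (\<Sum>k\<in>UNIV. f (fst k) * g (snd k) * (cmod ((cadj U ** X ** V) $ fst k $ snd k))\<^sup>2)"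
proof -
  let ?Y = "cadj U ** X ** V"
  have "trace (cadj X ** (U ** diag_mat f ** cadj U) ** X ** (V ** diag_mat g ** cadj V))
      = trace (cadj V ** (cadj X ** (U ** diag_mat f ** cadj U) ** X ** V ** diag_mat g))"
    by (metis trace_mul_sym matrix_mul_assoc)
  also have "\<dots> = trace ((cadj ?Y ** diag_mat f) ** (?Y ** diag_mat g))"
    by (simp add: cadj_mult matrix_mul_assoc)
  also have "\<dots> = (\<Sum>j\<in>UNIV. \<Sum>i\<in>UNIV. (cadj ?Y ** diag_mat f) $ j $ i * (?Y ** diag_mat g) $ i $ j)"
    unfolding trace_def matrix_matrix_mult_def[of "cadj ?Y ** diag_mat f"] by simp
  also have "\<dots> = (\<Sum>j\<in>UNIV. \<Sum>i\<in>UNIV. complex_of_real (f i * g j * (cmod (?Y $ i $ j))\<^sup>2))"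
    unfolding diag_mat_mult_right cadj_component of_real_mult complex_norm_square
    by (intro sum.cong refl) (simp add: mult_ac)
  also have "\<dots> = (\<Sum>i\<in>UNIV. \<Sum>j\<in>UNIV. complex_of_real (f i * g j * (cmod (?Y $ i $ j))\<^sup>2))"
    by (rule sum.swap)
  also have "\<dots> = complex_of_real (\<Sum>k\<in>UNIV. f (fst k) * g (snd k) * (cmod (?Y $ fst k $ snd k))\<^sup>2)"
    unfolding of_real_sum sum.cartesian_product UNIV_Times_UNIV
    by (intro sum.cong refl) auto
  finally show ?thesis .
qed

lemma diag_mat_1 [simp]: "diag_mat (\<lambda>_. 1) = mat 1"
  by (simp add: diag_mat_def mat_def vec_eq_iff)

lemma unitary_diag_1: "unitary_mat U \<Longrightarrow> U ** diag_mat (\<lambda>_. 1) ** cadj U = mat 1"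
  by (simp add: unitary_mat_def)

lemma trace_unitary_diag:
  assumes "unitary_mat U"
  shows "trace (U ** diag_mat d ** cadj U) = complex_of_real (\<Sum>i\<in>UNIV. d i)"
proof -
  have "trace (U ** diag_mat d ** cadj U) = trace (diag_mat d)"
    using assms by (metis trace_mul_sym matrix_mul_assoc matrix_mul_lid unitary_mat_def)
  then show ?thesis by (simp add: trace_def diag_mat_def)
qed

text \<open>
  The cases \<open>G = 1\<close> and \<open>F = 1\<close>.  The identity is diagonal in any orthonormal basis, so the
  second unitary may be chosen freely; choosing it equal to the one of another form diagonalizes
  both forms in the same coordinates.
\<close>

lemma trace_left_sandwich:
  fixes X :: "complex^'n^'n"
  assumes "unitary_mat V"
  shows "trace (cadj X ** (U ** diag_mat f ** cadj U) ** X) =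
    complex_of_real (\<Sum>k\<in>UNIV. f (fst k) * (cmod ((cadj U ** X ** V) $ fst k $ snd k))\<^sup>2)"
  using trace_weighted_sandwich[of X U f V "\<lambda>_. 1"] unitary_diag_1[OF assms]
  by simp

lemma trace_right_sandwich:
  fixes X :: "complex^'n^'n"
  assumes "unitary_mat U"
  shows "trace (cadj X ** X ** (V ** diag_mat g ** cadj V)) =
    complex_of_real (\<Sum>k\<in>UNIV. g (snd k) * (cmod ((cadj U ** X ** V) $ fst k $ snd k))\<^sup>2)"
  using trace_weighted_sandwich[of X U "\<lambda>_. 1" V g] unitary_diag_1[OF assms]
  by simp

lemma unitary_mat_prod:
  assumes "unitary_mat U" "unitary_mat V"
  shows "unitary_mat (cadj U ** V)"
proof -
  have "cadj (cadj U ** V) ** (cadj U ** V) = cadj V ** (U ** cadj U) ** V"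
    by (simp add: cadj_mult matrix_mul_assoc)
  also have "\<dots> = mat 1" using assms by (simp add: unitary_mat_def)
  finally show ?thesis by (simp add: unitary_mat_def matrix_left_right_inverse)
qed

lemma unitary_mat_cadj: "unitary_mat U \<Longrightarrow> unitary_mat (cadj U)"
  by (simp add: unitary_mat_def)

lemma unitary_col_sum:
  assumes "unitary_mat U" shows "(\<Sum>i\<in>UNIV. (cmod (U $ i $ j))\<^sup>2) = 1"
proof -
  have "complex_of_real (\<Sum>i\<in>UNIV. (cmod (U $ i $ j))\<^sup>2) = (cadj U ** U) $ j $ j"
    by (simp only: matrix_matrix_mult_def vec_lambda_beta cadj_component of_real_sum
        complex_norm_square mult.commute)
  also have "\<dots> = 1" using assms by (simp add: unitary_mat_def mat_def)
  finally show ?thesis by (simp only: of_real_eq_1_iff)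
qed

lemma unitary_row_sum:
  assumes "unitary_mat U" shows "(\<Sum>j\<in>UNIV. (cmod (U $ i $ j))\<^sup>2) = 1"
  using unitary_col_sum[OF unitary_mat_cadj[OF assms], of i] by simp

text \<open>
  A positive semidefinite matrix carried together with a chosen spectral decomposition.  Powers
  of \<open>A\<close> then share \<open>U\<close> and only change the eigenvalues.
\<close>

definition psd_spectral :: "complex^'n^'n \<Rightarrow> complex^'n^'n \<Rightarrow> ('n \<Rightarrow> real) \<Rightarrow> bool" where
  "psd_spectral A U d \<longleftrightarrow> unitary_mat U \<and> A = U ** diag_mat d ** cadj U \<and> (\<forall>i. 0 \<le> d i)"

lemma mat_powr_psd_spectral:
  "psd_spectral A U d \<Longrightarrow> mat_powr A r = U ** diag_mat (\<lambda>i. d i powr r) ** cadj U"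
  unfolding mat_powr_def psd_spectral_def by (rule mat_fun_eq) (auto simp: is_mat_fun_def)

lemma psd_spectral_powr:
  "psd_spectral A U d \<Longrightarrow> psd_spectral (mat_powr A r) U (\<lambda>i. d i powr r)"
  by (simp add: mat_powr_psd_spectral) (simp add: psd_spectral_def)

lemma mat_powr_1: "psd_spectral A U d \<Longrightarrow> mat_powr A 1 = A"
  by (simp add: mat_powr_psd_spectral) (simp add: psd_spectral_def)

lemma psd_spectral_cadj: "psd_spectral A U d \<Longrightarrow> cadj A = A"
  by (auto simp: psd_spectral_def cadj_mult matrix_mul_assoc)

lemma quad_form_column:
  "quad_form A (\<chi> i. U $ i $ j) = (cadj U ** A ** U) $ j $ j"
proof -
  have "quad_form A (\<chi> i. U $ i $ j) = (cadj U ** (A ** U)) $ j $ j"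
    by (simp add: quad_form_def matrix_matrix_mult_def matrix_vector_mult_def)
  then show ?thesis by (simp add: matrix_mul_assoc)
qed

lemma unitary_conj_cancel:
  assumes "unitary_mat U" "A = U ** D ** cadj U"
  shows "cadj U ** A ** U = D"
  using assms by (metis matrix_mul_assoc matrix_mul_lid matrix_mul_rid unitary_mat_def)

lemma pos_semidef_diag:
  assumes "pos_semidef A" obtains U d where "psd_spectral A U d"
proof -
  obtain U d where U: "unitary_mat U" "A = U ** diag_mat d ** cadj U"
    using hermitian_spectral_decomposition assms unfolding pos_semidef_def by blast
  have "0 \<le> d j" for j
  proof -
    have "0 \<le> quad_form A (\<chi> i. U $ i $ j)" using assms by (simp add: pos_semidef_def)
    also have "\<dots> = of_real (d j)"
      unfolding quad_form_column unitary_conj_cancel[OF U] by (simp add: diag_mat_def)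
    finally show ?thesis by (simp add: less_eq_complex_def)
  qed
  with U that show ?thesis by (auto simp: psd_spectral_def)
qed

lemma pos_def_imp_pos_semidef: "pos_def A \<Longrightarrow> pos_semidef A"
  unfolding pos_def_def pos_semidef_def
proof (intro conjI allI; elim conjE)
  fix x assume "\<forall>x. x \<noteq> 0 \<longrightarrow> 0 < quad_form A x"
  then show "0 \<le> quad_form A x"
    by (cases "x = 0") (auto simp: quad_form_def less_imp_le)
qed

lemma psd_spectral_trace_nonneg:
  fixes A X :: "complex^'n^'n"
  assumes "psd_spectral A U d" shows "0 \<le> trace (cadj X ** A ** X)"
proof -
  have "unitary_mat U" "A = U ** diag_mat d ** cadj U" "\<forall>i. 0 \<le> d i"
    using assms by (auto simp: psd_spectral_def)
  then show ?thesis
    by (simp add: trace_left_sandwich[of U] sum_nonneg less_eq_complex_def)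
qed

text \<open>
  Testing against the squares \<open>K\<^sup>* K\<close> suffices for positivity, because the spectral projections of
  \<open>Z\<close> are such squares and the corresponding traces are the eigenvalues.  This criterion fits
  matrices such as \<open>\<Psi>(C)\<close> that are known only through their pairing with other matrices.
\<close>

lemma psd_spectral_if_traces_nonneg:
  fixes Z :: "complex^'n^'n"
  assumes herm: "cadj Z = Z" and nn: "\<And>K :: complex^'n^'n. 0 \<le> trace (cadj K ** K ** Z)"
  obtains U d where "psd_spectral Z U d"
proof -
  obtain U d where U: "unitary_mat U" "Z = U ** diag_mat d ** cadj U"
    using hermitian_spectral_decomposition[OF herm] .
  have "0 \<le> d j" for j
  proof -
    \<comment> \<open>With \<open>K = e\<^sub>j\<^sub>j U\<^sup>*\<close>, the square \<open>K\<^sup>* K\<close> is the projection onto the \<open>j\<close>-th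
        eigenvector.\<close>
    let ?e = "diag_mat (\<lambda>i. if i = j then 1 else 0)"
    have ee: "?e ** ?e ** diag_mat d = diag_mat (\<lambda>i. if i = j then d j else 0)"
      by (simp add: vec_eq_iff diag_mat_mult_right) (simp add: diag_mat_def)
    have "cadj (?e ** cadj U) ** (?e ** cadj U) ** Z = U ** ?e ** ?e ** (cadj U ** U) ** diag_mat d ** cadj U"
      by (simp add: cadj_mult matrix_mul_assoc U(2))
    also have "\<dots> = U ** (?e ** ?e ** diag_mat d) ** cadj U"
      using U(1) by (simp add: unitary_mat_def matrix_mul_assoc)
    finally have "trace (cadj (?e ** cadj U) ** (?e ** cadj U) ** Z) = complex_of_real (d j)"
      unfolding ee by (simp add: trace_unitary_diag[OF U(1)])
    with nn[of "?e ** cadj U"] show ?thesis by (simp add: less_eq_complex_def)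
  qed
  with U that show ?thesis by (auto simp: psd_spectral_def)
qed

lemma psd_spectral_congruence:
  fixes P X :: "complex^'n^'n"
  assumes "psd_spectral P U d" obtains W e where "psd_spectral (cadj X ** P ** X) W e"
proof (rule psd_spectral_if_traces_nonneg)
  show "cadj (cadj X ** P ** X) = cadj X ** P ** X"
    using psd_spectral_cadj[OF assms] by (simp add: cadj_mult matrix_mul_assoc)
  show "0 \<le> trace (cadj K ** K ** (cadj X ** P ** X))" for K :: "complex^'n^'n"
  proof -
    have "trace (cadj K ** K ** (cadj X ** P ** X)) = trace (cadj (X ** cadj K) ** P ** (X ** cadj K))"
      by (simp add: cadj_mult) (metis trace_mul_sym matrix_mul_assoc)
    then show ?thesis using psd_spectral_trace_nonneg[OF assms] by simp
  qed
qed

lemma trace_pos_semidef_mult: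
  assumes P: "pos_semidef P" and C: "psd_spectral C V c"
  shows "0 \<le> trace (P ** C)"
proof -
  have "trace (P ** C) = trace ((cadj V ** P ** V) ** diag_mat c)"
    using C unfolding psd_spectral_def by (metis trace_mul_sym matrix_mul_assoc)
  also have "\<dots> = (\<Sum>j\<in>UNIV. quad_form P (\<chi> i. V $ i $ j) * complex_of_real (c j))"
    by (simp add: trace_def diag_mat_mult_right quad_form_column)
  also have "\<dots> \<ge> 0"
    using P C by (intro sum_nonneg mult_nonneg_nonneg) (auto simp: pos_semidef_def psd_spectral_def less_eq_complex_def)
  finally show ?thesis .
qed

text \<open>
  A trace version of Young's inequality \<open>x y\<^bsup>1-r\<^esup> \<le> r x\<^bsup>1/r\<^esup> + (1 - r) y\<close>.  With the weights
  \<open>|(W\<^sup>* V)\<^sub>i\<^sub>j|\<^sup>2\<close> both sides are averages of the scalar inequality over pairs of eigenvalues;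
  rows and columns of the weights sum to one, so each term on the right collapses to a trace.
\<close>

lemma trace_mult_powr_le:
  assumes P: "psd_spectral P W a" and D: "psd_spectral D V d" and r: "0 < r" "r < 1"
  shows "Re (trace (P ** mat_powr D (1 - r))) \<le>
    r * Re (trace (mat_powr P (1 / r))) + (1 - r) * Re (trace D)"
proof -
  let ?u = "\<lambda>i j. (cmod ((cadj W ** V) $ i $ j))\<^sup>2"
  have U: "unitary_mat W" "unitary_mat V" "P = W ** diag_mat a ** cadj W"
    "D = V ** diag_mat d ** cadj V" "\<And>i. 0 \<le> a i" "\<And>i. 0 \<le> d i"
    using P D by (auto simp: psd_spectral_def)
  have young: "x * y powr (1 - r) \<le> r * x powr (1 / r) + (1 - r) * y" if "0 \<le> x" "0 \<le> y" for x y
  proof (cases "x = 0 \<or> y = 0")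
    case False
    then show ?thesis
      using Youngs_inequality_0[of r "1 - r" "x powr (1 / r)" y] that r by (simp add: powr_powr)
  qed (use that r in auto)
  have "Re (trace (P ** mat_powr D (1 - r))) =
     (\<Sum>k\<in>UNIV. a (fst k) * d (snd k) powr (1 - r) * ?u (fst k) (snd k))"
    using trace_weighted_sandwich[of "mat 1" W a V "\<lambda>i. d i powr (1 - r)"]
    by (simp add: mat_powr_psd_spectral[OF D] U(3)[symmetric])
  also have "\<dots> = (\<Sum>i\<in>UNIV. \<Sum>j\<in>UNIV. a i * d j powr (1 - r) * ?u i j)"
    unfolding sum.cartesian_product UNIV_Times_UNIV by (intro sum.cong) auto
  also have "\<dots> \<le> (\<Sum>i\<in>UNIV. \<Sum>j\<in>UNIV. (r * a i powr (1 / r) + (1 - r) * d j) * ?u i j)"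
    by (intro sum_mono mult_right_mono young U) auto
  also have "\<dots> = (\<Sum>i\<in>UNIV. \<Sum>j\<in>UNIV. r * a i powr (1 / r) * ?u i j) +
      (\<Sum>i\<in>UNIV. \<Sum>j\<in>UNIV. (1 - r) * d j * ?u i j)"
    by (simp only: distrib_right sum.distrib)
  also have "(\<Sum>i\<in>UNIV. \<Sum>j\<in>UNIV. (1 - r) * d j * ?u i j) =
      (\<Sum>j\<in>UNIV. \<Sum>i\<in>UNIV. (1 - r) * d j * ?u i j)"
    by (rule sum.swap)
  also have "(\<Sum>i\<in>UNIV. \<Sum>j\<in>UNIV. r * a i powr (1 / r) * ?u i j) = r * (\<Sum>i\<in>UNIV. a i powr (1 / r))"
    using unitary_row_sum[OF unitary_mat_prod[OF U(1,2)]]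
    by (simp flip: sum_distrib_left)
  also have "(\<Sum>j\<in>UNIV. \<Sum>i\<in>UNIV. (1 - r) * d j * ?u i j) = (1 - r) * (\<Sum>j\<in>UNIV. d j)"
    using unitary_col_sum[OF unitary_mat_prod[OF U(1,2)]]
    by (simp flip: sum_distrib_left)
  also have "(\<Sum>i\<in>UNIV. a i powr (1 / r)) = Re (trace (mat_powr P (1 / r)))"
    by (simp add: mat_powr_psd_spectral[OF P] trace_unitary_diag U(1))
  also have "(\<Sum>j\<in>UNIV. d j) = Re (trace D)"
    by (simp add: U(4) trace_unitary_diag U(2))
  finally show ?thesis .
qed

section \<open>Parallel sums and weighted geometric means\<close>

text \<open>
  Division by zero gives \<open>parallel_sum 0 0 = 0\<close>, which is the value by continuity.
\<close>

definition parallel_sum :: "real \<Rightarrow> real \<Rightarrow> real" where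
  "parallel_sum x y = x * y / (x + y)"

text \<open>
  The parallel sum bounds the cost of every splitting \<open>u + v\<close> from below, the defect being the
  square of \<open>x |u| - y |v|\<close>.
\<close>

lemma parallel_sum_le:
  fixes u v :: complex
  assumes "0 \<le> x" "0 \<le> y"
  shows "parallel_sum x y * (cmod (u + v))\<^sup>2 \<le> x * (cmod u)\<^sup>2 + y * (cmod v)\<^sup>2"
proof (cases "x + y = 0")
  case False
  then have pos: "x + y > 0" using assms by linarith
  let ?a = "cmod u" and ?b = "cmod v"
  have "(cmod (u + v))\<^sup>2 \<le> (?a + ?b)\<^sup>2"
    by (simp add: norm_triangle_ineq power_mono)
  then have "x * y * (cmod (u + v))\<^sup>2 \<le> x * y * (?a + ?b)\<^sup>2"
    using assms by (simp add: mult_left_mono)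
  also have "\<dots> = (x * ?a\<^sup>2 + y * ?b\<^sup>2) * (x + y) - (x * ?a - y * ?b)\<^sup>2"
    by (simp add: algebra_simps power2_eq_square)
  also have "\<dots> \<le> (x * ?a\<^sup>2 + y * ?b\<^sup>2) * (x + y)" by simp
  finally show ?thesis
    using pos by (simp add: parallel_sum_def field_simps)
qed (use assms in \<open>simp add: parallel_sum_def\<close>)

text \<open>
  The splitting of \<open>u\<close> in the ratio \<open>y : x\<close> attains the bound of \<open>parallel_sum_le\<close>.  For
  \<open>x = y = 0\<close> the ratio is read as zero and both sides vanish.
\<close>

lemma parallel_sum_split:
  fixes u :: complex
  assumes "0 \<le> x" "0 \<le> y"
  shows "x * (cmod (of_real (y / (x + y)) * u))\<^sup>2 + y * (cmod (u - of_real (y / (x + y)) * u))\<^sup>2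
    = parallel_sum x y * (cmod u)\<^sup>2"
proof (cases "x + y = 0")
  case True
  then show ?thesis using assms by (simp add: parallel_sum_def)
next
  case False
  have "u - of_real (y / (x + y)) * u = of_real (1 - y / (x + y)) * u"
    by (simp add: algebra_simps)
  also have "1 - y / (x + y) = x / (x + y)" using False by (simp add: field_simps)
  finally have "cmod (u - of_real (y / (x + y)) * u) = x / (x + y) * cmod u"
    using assms by (simp add: norm_mult norm_divide del: of_real_divide of_real_add)
  moreover have "cmod (of_real (y / (x + y)) * u) = y / (x + y) * cmod u"
    using assms by (simp add: norm_mult norm_divide del: of_real_divide of_real_add)
  moreover have "x * (y / (x + y) * z)\<^sup>2 + y * (x / (x + y) * z)\<^sup>2 = x * y / (x + y) * z\<^sup>2" for z
  proof -
    have "x * (y / (x + y) * z)\<^sup>2 + y * (x / (x + y) * z)\<^sup>2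
        = (x * y * (x + y)) / ((x + y) * (x + y)) * z\<^sup>2"
      by (simp add: power2_eq_square add_divide_distrib distrib_left distrib_right mult_ac)
    also have "\<dots> = x * y / (x + y) * z\<^sup>2" using False by simp
    finally show ?thesis .
  qed
  ultimately show ?thesis by (simp add: parallel_sum_def)
qed

text \<open>
  The Beta function value \<open>B(1 - s, s)\<close>, equal to \<open>\<pi> / sin (\<pi> s)\<close> for \<open>0 < s < 1\<close>.
\<close>

definition beta_integral :: "real \<Rightarrow> ennreal" where
  "beta_integral s = (\<integral>\<^sup>+u. ennreal (u powr (- s) / (1 + u)) * indicator {0<..} u \<partial>lborel)"

text \<open>
  The integrand is dominated by \<open>u\<^bsup>-s\<^esup>\<close> near zero and by \<open>u\<^bsup>-s-1\<^esup>\<close> near infinity.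
\<close>

lemma beta_integral_finite:
  assumes "0 < s" "s < 1"
  shows "beta_integral s < top"
proof -
  have "beta_integral s \<le> (\<integral>\<^sup>+u. ennreal (u powr (- s)) * indicator {0..1} u
      + ennreal (u powr (- s - 1)) * indicator {1..} u \<partial>lborel)"
    unfolding beta_integral_def
  proof (intro nn_integral_mono)
    fix u :: real
    consider "u \<le> 0" | "0 < u" "u \<le> 1" | "1 < u" by linarith
    then show "ennreal (u powr (- s) / (1 + u)) * indicator {0<..} u \<le>
       ennreal (u powr (- s)) * indicator {0..1} u + ennreal (u powr (- s - 1)) * indicator {1..} u"
    proof cases
      case 2
      then have "u powr (- s) / (1 + u) \<le> u powr (- s)" by (simp add: field_simps)
      then show ?thesis using 2 by (auto simp: indicator_def ennreal_leI add_increasing2)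
    next
      case 3
      then have "u powr (- s) / (1 + u) \<le> u powr (- s) / u" by (intro divide_left_mono) auto
      also have "\<dots> = u powr (- s - 1)" using 3 by (simp add: powr_diff)
      finally show ?thesis using 3 by (simp add: ennreal_leI)
    qed simp
  qed
  also have "\<dots> = (\<integral>\<^sup>+u. ennreal (u powr (- s)) * indicator {0..1} u \<partial>lborel)
      + (\<integral>\<^sup>+u. ennreal (u powr (- s - 1)) * indicator {1..} u \<partial>lborel)"
    by (intro nn_integral_add) auto
  also have "\<dots> = ennreal (1 powr (- s + 1) / (- s + 1)) + ennreal (-(1 powr (- s - 1 + 1)) / (- s - 1 + 1))"
    using assms
    by (intro arg_cong2[where f="(+)"] nn_integral_has_integral_lebesgue'
        has_integral_powr_from_0 has_integral_powr_to_inf) auto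
  also have "\<dots> < top" by simp
  finally show ?thesis .
qed

lemma beta_integral_pos:
  assumes "0 < s"
  shows "beta_integral s \<noteq> 0"
proof -
  have "0 < ennreal (2 powr (- s) / 3) * emeasure lborel {1..2::real}"
    by (simp flip: ennreal_mult')
  also have "\<dots> = (\<integral>\<^sup>+u. ennreal (2 powr (- s) / 3) * indicator {1..2::real} u \<partial>lborel)"
    by (simp add: nn_integral_cmult_indicator)
  also have "\<dots> \<le> beta_integral s"
    unfolding beta_integral_def
  proof (intro nn_integral_mono)
    fix u :: real
    show "ennreal (2 powr (- s) / 3) * indicator {1..2} u \<le>
      ennreal (u powr (- s) / (1 + u)) * indicator {0<..} u"
    proof (cases "u \<in> {1..2}")
      case True
      then have "2 powr (- s) \<le> u powr (- s)" using assms by (intro powr_mono2') auto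
      then have "2 powr (- s) / 3 \<le> u powr (- s) / (1 + u)"
        using True by (intro frac_le) auto
      then show ?thesis using True by (simp add: ennreal_leI)
    qed simp
  qed
  finally show ?thesis by auto
qed

text \<open>
  The substitution \<open>t = (y / x) u\<close> turns the integral into the Beta integral.
\<close>

lemma nn_integral_parallel_sum:
  assumes s: "0 < s" "s < 1" and "0 \<le> x" "0 \<le> y"
  shows "(\<integral>\<^sup>+t. ennreal (t powr (- s - 1) * parallel_sum (t * x) y) * indicator {0<..} t \<partial>lborel)
       = ennreal (x powr s * y powr (1 - s)) * beta_integral s"
proof (cases "x = 0 \<or> y = 0")
  case True
  then show ?thesis by (auto simp: parallel_sum_def)
next
  case False
  then have pos: "x > 0" "y > 0" using assms by auto
  let ?h = "\<lambda>t. ennreal (t powr (- s - 1) * parallel_sum (t * x) y) * indicator {0<..} t"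
  have [measurable]: "?h \<in> borel_measurable borel"
    unfolding parallel_sum_def by measurable
  have "(\<integral>\<^sup>+t. ?h t \<partial>lborel) = \<bar>y / x\<bar> * (\<integral>\<^sup>+u. ?h (0 + y / x * u) \<partial>lborel)"
    using pos by (intro nn_integral_real_affine) auto
  also have "\<dots> = (\<integral>\<^sup>+u. \<bar>y / x\<bar> * ?h (0 + y / x * u) \<partial>lborel)"
    by (intro nn_integral_cmult[symmetric]) measurable
  also have "\<dots> = (\<integral>\<^sup>+u. ennreal (x powr s * y powr (1 - s)) *
      (ennreal (u powr (- s) / (1 + u)) * indicator {0<..} u) \<partial>lborel)"
  proof (intro nn_integral_cong)
    fix u :: real
    show "\<bar>y / x\<bar> * ?h (0 + y / x * u) =
      ennreal (x powr s * y powr (1 - s)) * (ennreal (u powr (- s) / (1 + u)) * indicator {0<..} u)"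
    proof (cases "u > 0")
      case True
      have ps: "parallel_sum (y / x * u * x) y = y * u / (1 + u)"
      proof -
        have "parallel_sum (y / x * u * x) y = y * (y * u) / (y * (1 + u))"
          using pos by (simp add: parallel_sum_def algebra_simps)
        then show ?thesis using pos by simp
      qed
      have "(y / x) * ((y / x * u) powr (- s - 1) * parallel_sum (y / x * u * x) y)
          = (y / x) * ((y / x) powr (- s - 1) * u powr (- s - 1) * (y * u / (1 + u)))"
        unfolding ps using pos True by (subst powr_mult) auto
      also have "\<dots> = ((y / x) * (y / x) powr (- s - 1) * y) * (u * u powr (- s - 1) / (1 + u))"
        by simp
      also have "u * u powr (- s - 1) = u powr (- s)"
        using True by (simp add: powr_diff)
      also have "(y / x) * (y / x) powr (- s - 1) = (y / x) powr (- s)"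
        using pos by (simp add: powr_diff)
      also have "(y / x) powr (- s) * y = x powr s * y powr (1 - s)"
        using pos by (simp add: powr_divide powr_minus powr_diff field_simps)
      finally have eq: "(y / x) * ((y / x * u) powr (- s - 1) * parallel_sum (y / x * u * x) y) =
          x powr s * y powr (1 - s) * (u powr (- s) / (1 + u))" .
      have *: "0 < y / x * u" "\<bar>y / x\<bar> = y / x" "0 \<le> y / x" using pos True by auto
      show ?thesis
        using True pos * unfolding add_0 *(2) eq[symmetric]
        by (simp only: indicator_def greaterThan_iff if_True mult_1_right of_bool_eq
            ennreal_mult'[OF *(3), symmetric] eq)
          (simp only: eq ennreal_mult'[symmetric] mult_nonneg_nonneg powr_ge_zero)
    next
      case False
      then have "y / x * u \<le> 0" using pos by (intro mult_nonneg_nonpos) auto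
      then show ?thesis using False by simp
    qed
  qed
  also have "\<dots> = ennreal (x powr s * y powr (1 - s)) * beta_integral s"
    unfolding beta_integral_def by (intro nn_integral_cmult) measurable
  finally show ?thesis .
qed

text \<open>
  Inequalities between weighted parallel sums pass to weighted geometric means by integrating
  them against \<open>t\<^bsup>-s-1\<^esup>\<close> and cancelling the positive finite Beta constant.
\<close>

lemma powr_means_le_if_parallel_sums_le:
  fixes a c w :: "'i \<Rightarrow> real" and a' c' w' :: "'j \<Rightarrow> real"
  assumes s: "0 < s" "s < 1"
    and nn: "\<And>k. 0 \<le> a k" "\<And>k. 0 \<le> c k" "\<And>k. 0 \<le> w k"
      "\<And>k. 0 \<le> a' k" "\<And>k. 0 \<le> c' k" "\<And>k. 0 \<le> w' k"
    and le: "\<And>t. 0 < t \<Longrightarrow> (\<Sum>k\<in>I. parallel_sum (t * a k) (c k) * w k)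
       \<le> (\<Sum>k\<in>J. parallel_sum (t * a' k) (c' k) * w' k)"
  shows "(\<Sum>k\<in>I. a k powr s * c k powr (1 - s) * w k)
      \<le> (\<Sum>k\<in>J. a' k powr s * c' k powr (1 - s) * w' k)"
proof -
  have int: "(\<integral>\<^sup>+t. ennreal (t powr (- s - 1) * (\<Sum>k\<in>K. parallel_sum (t * x k) (y k) * z k)) * indicator {0<..} t \<partial>lborel)
    = beta_integral s * ennreal (\<Sum>k\<in>K. x k powr s * y k powr (1 - s) * z k)"
    if nn: "\<And>k. 0 \<le> x k" "\<And>k. 0 \<le> y k" "\<And>k. 0 \<le> z k"
    for x y z :: "'k \<Rightarrow> real" and K
  proof -
    have "(\<integral>\<^sup>+t. ennreal (t powr (- s - 1) * (\<Sum>k\<in>K. parallel_sum (t * x k) (y k) * z k)) * indicator {0<..} t \<partial>lborel)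
      = (\<integral>\<^sup>+t. (\<Sum>k\<in>K. ennreal (z k) * (ennreal (t powr (- s - 1) * parallel_sum (t * x k) (y k)) * indicator {0<..} t)) \<partial>lborel)"
    proof (intro nn_integral_cong)
      fix t :: real
      show "ennreal (t powr (- s - 1) * (\<Sum>k\<in>K. parallel_sum (t * x k) (y k) * z k)) * indicator {0<..} t
        = (\<Sum>k\<in>K. ennreal (z k) * (ennreal (t powr (- s - 1) * parallel_sum (t * x k) (y k)) * indicator {0<..} t))"
      proof (cases "t > 0")
        case True
        then show ?thesis
          using nn by (simp add: sum_distrib_left mult_ac parallel_sum_def
              flip: ennreal_mult' ennreal_mult sum_ennreal)
      qed simp
    qed
    also have "\<dots> = (\<Sum>k\<in>K. (\<integral>\<^sup>+t. ennreal (z k) * (ennreal (t powr (- s - 1) * parallel_sum (t * x k) (y k)) * indicator {0<..} t) \<partial>lborel))"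
      unfolding parallel_sum_def by (intro nn_integral_sum) measurable
    also have "\<dots> = (\<Sum>k\<in>K. ennreal (z k) * (ennreal (x k powr s * y k powr (1 - s)) * beta_integral s))"
    proof (intro sum.cong refl)
      fix k
      show "(\<integral>\<^sup>+t. ennreal (z k) * (ennreal (t powr (- s - 1) * parallel_sum (t * x k) (y k)) * indicator {0<..} t) \<partial>lborel)
        = ennreal (z k) * (ennreal (x k powr s * y k powr (1 - s)) * beta_integral s)"
        unfolding nn_integral_parallel_sum[OF s nn(1,2), symmetric] parallel_sum_def
        by (intro nn_integral_cmult) measurable
    qed
    also have "\<dots> = beta_integral s * (\<Sum>k\<in>K. ennreal (x k powr s * y k powr (1 - s) * z k))"
      using nn by (simp add: sum_distrib_left mult_ac ennreal_mult)
    also have "\<dots> = beta_integral s * ennreal (\<Sum>k\<in>K. x k powr s * y k powr (1 - s) * z k)"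
      using nn by (subst sum_ennreal) auto
    finally show ?thesis .
  qed
  have "beta_integral s * ennreal (\<Sum>k\<in>I. a k powr s * c k powr (1 - s) * w k)
     \<le> beta_integral s * ennreal (\<Sum>k\<in>J. a' k powr s * c' k powr (1 - s) * w' k)"
    unfolding int[OF nn(1-3), symmetric] int[OF nn(4-6), symmetric]
    by (intro nn_integral_mono) (auto simp: indicator_def intro!: ennreal_leI mult_left_mono le)
  then have "ennreal (\<Sum>k\<in>I. a k powr s * c k powr (1 - s) * w k)
     \<le> ennreal (\<Sum>k\<in>J. a' k powr s * c' k powr (1 - s) * w' k)"
    using beta_integral_finite[OF s] beta_integral_pos[OF s(1)]
    by (simp add: ennreal_mult_le_mult_iff)
  then show ?thesis
    using nn by (subst (asm) ennreal_le_iff) (auto intro!: sum_nonneg)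
qed

section \<open>Unital Schwarz maps\<close>

locale unital_schwarz_map =
  fixes \<Phi> :: "complex^'m^'m \<Rightarrow> complex^'n^'n"
  assumes schwarz_map: "schwarz_map \<Phi>" and unital: "unital \<Phi>"
begin

sublocale L: Vector_Spaces.linear cscale cscale \<Phi>
  using schwarz_map by (simp add: schwarz_map_def)

abbreviation "\<Psi> \<equiv> hs_adjoint \<Phi>"

lemma trace_hs_adjoint: "trace (cadj (\<Phi> X) ** Y) = trace (cadj X ** \<Psi> Y)"
  for Y :: "complex^'n^'n"
  using hs_adjoint_works[OF L.linear_axioms] by (simp add: hs_inner_def)

lemma schwarz: "pos_semidef (\<Phi> (cadj X ** X) - cadj (\<Phi> X) ** \<Phi> X)"
  using schwarz_map by (simp add: schwarz_map_def loewner_le_def)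

lemma Phi_1 [simp]: "\<Phi> (mat 1) = mat 1"
  using unital by (simp add: unital_def)

lemma hermitian_image_square: "cadj (\<Phi> (cadj X ** X)) = \<Phi> (cadj X ** X)" for X :: "complex^'m^'m"
  using schwarz[of X] by (simp add: pos_semidef_def cadj_diff cadj_mult)

text \<open>
  Squares have Hermitian images.  For the square of \<open>X + c\<close> this says that
  \<open>c \<Phi>(X\<^sup>*) + cnj c \<Phi>(X)\<close> is Hermitian, and the choices \<open>c = 1\<close> and \<open>c = \<i>\<close> separate the two
  terms.
\<close>

lemma Phi_cadj: "\<Phi> (cadj X) = cadj (\<Phi> X)"
proof -
  have herm: "cscale c (\<Phi> (cadj X)) + cscale (cnj c) (\<Phi> X)
      = cscale (cnj c) (cadj (\<Phi> (cadj X))) + cscale c (cadj (\<Phi> X))" for c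
  proof -
    let ?Y = "X + cscale c (mat 1)"
    have "cadj ?Y ** ?Y = cadj X ** X + (cscale c (cadj X) + cscale (cnj c) X)
       + cscale (cnj c * c) (mat 1)"
      by (simp add: cadj_add cadj_cscale matrix_add_ldistrib matrix_add_rdistrib
            cscale_mat_1_mult mult_cscale_mat_1)
         (simp add: vec_eq_iff cscale_def algebra_simps)
    from hermitian_image_square[of ?Y, unfolded this] show ?thesis
      by (simp add: L.add L.scale cadj_add cadj_cscale hermitian_image_square)
        (simp add: mult.commute add.commute)
  qed
  have "\<Phi> (cadj X) $ i $ j = cadj (\<Phi> X) $ i $ j" for i j
  proof -
    have "\<Phi> (cadj X) $ i $ j + \<Phi> X $ i $ j = cadj (\<Phi> (cadj X)) $ i $ j + cadj (\<Phi> X) $ i $ j"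
      using arg_cong[OF herm[of 1], of "\<lambda>Z. Z $ i $ j"] by (simp add: cscale_def del: cadj_component)
    moreover have "\<i> * (\<Phi> (cadj X) $ i $ j - \<Phi> X $ i $ j) = \<i> * (cadj (\<Phi> X) $ i $ j - cadj (\<Phi> (cadj X)) $ i $ j)"
      using arg_cong[OF herm[of \<i>], of "\<lambda>Z. Z $ i $ j"]
      by (simp add: cscale_def algebra_simps del: cadj_component)
    then have "\<Phi> (cadj X) $ i $ j - \<Phi> X $ i $ j = cadj (\<Phi> X) $ i $ j - cadj (\<Phi> (cadj X)) $ i $ j"
      by (simp del: cadj_component)
    moreover have "x + y = d + c \<Longrightarrow> x - y = c - d \<Longrightarrow> x = c" for x y c d :: complex
      by (simp add: complex_eq_iff)
    ultimately show ?thesis by blast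
  qed
  then show ?thesis by (simp only: vec_eq_iff) simp
qed

text \<open>
  Since \<open>\<Phi>\<close> commutes with \<open>cadj\<close>, both sides have the same inner products with every \<open>X\<close>.
\<close>

lemma hs_adjoint_cadj:
  assumes "cadj A = A" shows "cadj (\<Psi> A) = \<Psi> A"
proof -
  have "hs_inner X (cadj (\<Psi> A)) = hs_inner X (\<Psi> A)" for X
  proof -
    have "hs_inner X (cadj (\<Psi> A)) = cnj (trace (\<Psi> A ** X))"
      unfolding hs_inner_def by (simp flip: trace_cadj add: cadj_mult)
    also have "trace (\<Psi> A ** X) = trace (cadj (cadj X) ** \<Psi> A)"
      by (simp add: trace_mul_sym[of "\<Psi> A"])
    also have "\<dots> = trace (\<Phi> X ** A)"
      unfolding trace_hs_adjoint[symmetric] Phi_cadj by simp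
    also have "cnj \<dots> = trace (cadj (\<Phi> X) ** A)"
      unfolding trace_cadj[symmetric] cadj_mult assms by (rule trace_mul_sym)
    also have "\<dots> = hs_inner X (\<Psi> A)" by (simp add: trace_hs_adjoint hs_inner_def)
    finally show ?thesis .
  qed
  then have "hs_inner (cadj (\<Psi> A) - \<Psi> A) (cadj (\<Psi> A) - \<Psi> A) = 0"
    by (simp add: hs_inner_def matrix_diff_ldistrib trace_sub)
  moreover have "hs_inner Z Z = complex_of_real (\<Sum>i\<in>UNIV. \<Sum>j\<in>UNIV. (cmod (Z $ i $ j))\<^sup>2)"
    for Z :: "complex^'m^'m"
    unfolding of_real_sum complex_norm_square hs_inner_eq by (simp only: mult.commute)
  moreover have "(\<Sum>i\<in>UNIV. \<Sum>j\<in>UNIV. (cmod (Z $ i $ j))\<^sup>2) = 0 \<Longrightarrow> Z = 0"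
    for Z :: "complex^'m^'m"
    by (simp add: sum_nonneg_eq_0_iff sum_nonneg vec_eq_iff)
  ultimately have "cadj (\<Psi> A) - \<Psi> A = 0" by (metis of_real_eq_0_iff)
  then show ?thesis by simp
qed

text \<open>
  The end point \<open>s = 0\<close> of Lieb's functional: the Schwarz inequality paired with \<open>C\<close>.
\<close>

lemma schwarz_trace_right:
  fixes K :: "complex^'m^'m"
  assumes "psd_spectral C V c"
  shows "trace (cadj (\<Phi> K) ** \<Phi> K ** C) \<le> trace (cadj K ** K ** \<Psi> C)"
proof -
  have "trace (cadj K ** K ** \<Psi> C) = trace (\<Phi> (cadj K ** K) ** C)"
    using trace_hs_adjoint[of "cadj K ** K" C]
    by (simp add: hermitian_image_square cadj_mult)
  moreover have "0 \<le> trace ((\<Phi> (cadj K ** K) - cadj (\<Phi> K) ** \<Phi> K) ** C)"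
    by (rule trace_pos_semidef_mult[OF schwarz assms])
  ultimately show ?thesis
    by (simp add: matrix_diff_rdistrib trace_sub)
qed

text \<open>
  The end point \<open>s = 1\<close>: the Schwarz inequality for \<open>K\<^sup>*\<close>, after a cyclic permutation.
\<close>

lemma schwarz_trace_left:
  fixes K :: "complex^'m^'m"
  assumes "psd_spectral A U a"
  shows "trace (cadj (\<Phi> K) ** A ** \<Phi> K) \<le> trace (cadj K ** \<Psi> A ** K)"
  using schwarz_trace_right[OF assms, of "cadj K"]
    trace_cyclic[of "cadj (\<Phi> K)" A "\<Phi> K"] trace_cyclic[of "cadj K" "\<Psi> A" K]
  by (simp add: Phi_cadj)

lemma hs_adjoint_psd_spectral:
  assumes "psd_spectral C V c" obtains W e where "psd_spectral (\<Psi> C) W e"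
proof (rule psd_spectral_if_traces_nonneg)
  show "cadj (\<Psi> C) = \<Psi> C" by (rule hs_adjoint_cadj[OF psd_spectral_cadj[OF assms]])
  show "0 \<le> trace (cadj K ** K ** \<Psi> C)" for K :: "complex^'m^'m"
  proof -
    have "0 \<le> trace (cadj (cadj (\<Phi> K)) ** C ** cadj (\<Phi> K))"
      by (rule psd_spectral_trace_nonneg[OF assms])
    also have "\<dots> = trace (cadj (\<Phi> K) ** \<Phi> K ** C)"
      by (simp, metis trace_mul_sym matrix_mul_assoc)
    also have "\<dots> \<le> trace (cadj K ** K ** \<Psi> C)" by (rule schwarz_trace_right[OF assms])
    finally show ?thesis .
  qed
qed

lemma trace_hs_adjoint_eq: "trace (\<Psi> C) = trace C"
  using trace_hs_adjoint[of "mat 1" C] by simp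

text \<open>
  For every \<open>t > 0\<close> the parallel sum forms of \<open>(t A, C)\<close> and \<open>(t \<Psi>(A), \<Psi>(C))\<close> are compared by
  taking the optimal splitting \<open>K = K\<^sub>1 + K\<^sub>2\<close> for the second pair and using its image
  \<open>\<Phi>(K) = \<Phi>(K\<^sub>1) + \<Phi>(K\<^sub>2)\<close> as a competitor for the first.  Integration over \<open>t\<close> gives the
  powers.
\<close>

theorem lieb_functional_monotone:
  assumes s: "0 < s" "s < 1" and A: "psd_spectral A U a" and C: "psd_spectral C V c"
  shows "Re (trace (cadj (\<Phi> K) ** mat_powr A s ** \<Phi> K ** mat_powr C (1 - s)))
    \<le> Re (trace (cadj K ** mat_powr (\<Psi> A) s ** K ** mat_powr (\<Psi> C) (1 - s)))"
proof -
  obtain U' a' where A': "psd_spectral (\<Psi> A) U' a'" using hs_adjoint_psd_spectral[OF A] .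
  obtain V' c' where C': "psd_spectral (\<Psi> C) V' c'" using hs_adjoint_psd_spectral[OF C] .
  define f where "f X k = (cadj U ** X ** V) $ fst k $ snd k" for X k
  define f' where "f' X k = (cadj U' ** X ** V') $ fst k $ snd k" for X k
  have UV: "unitary_mat U" "unitary_mat V" "A = U ** diag_mat a ** cadj U" "C = V ** diag_mat c ** cadj V"
    "\<And>i. 0 \<le> a i" "\<And>i. 0 \<le> c i" using A C by (auto simp: psd_spectral_def)
  have UV': "unitary_mat U'" "unitary_mat V'" "\<Psi> A = U' ** diag_mat a' ** cadj U'"
    "\<Psi> C = V' ** diag_mat c' ** cadj V'"
    "\<And>i. 0 \<le> a' i" "\<And>i. 0 \<le> c' i" using A' C' by (auto simp: psd_spectral_def)
  have left: "trace (cadj X ** A ** X) = complex_of_real (\<Sum>k\<in>UNIV. a (fst k) * (cmod (f X k))\<^sup>2)" for X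
    unfolding f_def UV(3) by (rule trace_left_sandwich[OF UV(2)])
  have left': "trace (cadj X ** \<Psi> A ** X) = complex_of_real (\<Sum>k\<in>UNIV. a' (fst k) * (cmod (f' X k))\<^sup>2)" for X
    unfolding f'_def UV'(3) by (rule trace_left_sandwich[OF UV'(2)])
  have right: "trace (cadj X ** X ** C) = complex_of_real (\<Sum>k\<in>UNIV. c (snd k) * (cmod (f X k))\<^sup>2)" for X
    unfolding f_def UV(4) by (rule trace_right_sandwich[OF UV(1)])
  have right': "trace (cadj X ** X ** \<Psi> C) = complex_of_real (\<Sum>k\<in>UNIV. c' (snd k) * (cmod (f' X k))\<^sup>2)" for X
    unfolding f'_def UV'(4) by (rule trace_right_sandwich[OF UV'(1)])
  have par: "(\<Sum>k\<in>UNIV. parallel_sum (t * a (fst k)) (c (snd k)) * (cmod (f (\<Phi> K) k))\<^sup>2)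
      \<le> (\<Sum>k\<in>UNIV. parallel_sum (t * a' (fst k)) (c' (snd k)) * (cmod (f' K k))\<^sup>2)" if t: "0 < t" for t
  proof -
    \<comment> \<open>The splitting is optimal entry by entry in the eigenbases of \<open>\<Psi>(A)\<close> and
      \<open>\<Psi>(C)\<close>, see \<open>parallel_sum_split\<close>.\<close>
    define \<theta> where "\<theta> k = c' (snd k) / (t * a' (fst k) + c' (snd k))" for k
    define K1 where "K1 = U' ** (\<chi> i j. of_real (\<theta> (i, j)) * f' K (i, j)) ** cadj V'"
    have f1: "f' K1 k = of_real (\<theta> k) * f' K k" for k
    proof -
      have "cadj U' ** K1 ** V' = (\<chi> i j. of_real (\<theta> (i, j)) * f' K (i, j))"
      proof -
        have "cadj U' ** (U' ** D ** cadj V') ** V' = (cadj U' ** U') ** D ** (cadj V' ** V')" for D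
          by (simp only: matrix_mul_assoc)
        then show ?thesis using UV'(1,2) by (simp add: K1_def unitary_mat_def)
      qed
      then show ?thesis by (simp add: f'_def)
    qed
    have f2: "f' (K - K1) k = f' K k - of_real (\<theta> k) * f' K k" for k
      unfolding f1[symmetric] by (simp add: f'_def matrix_diff_ldistrib matrix_diff_rdistrib)
    have split: "f (\<Phi> K) k = f (\<Phi> K1) k + f (\<Phi> (K - K1)) k" for k
      by (simp add: f_def L.diff matrix_diff_ldistrib matrix_diff_rdistrib)
    have "(\<Sum>k\<in>UNIV. parallel_sum (t * a (fst k)) (c (snd k)) * (cmod (f (\<Phi> K) k))\<^sup>2)
       \<le> (\<Sum>k\<in>UNIV. t * a (fst k) * (cmod (f (\<Phi> K1) k))\<^sup>2 + c (snd k) * (cmod (f (\<Phi> (K - K1)) k))\<^sup>2)"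
      unfolding split using t UV(5,6) by (intro sum_mono parallel_sum_le) auto
    also have "\<dots> = t * Re (trace (cadj (\<Phi> K1) ** A ** \<Phi> K1)) + Re (trace (cadj (\<Phi> (K - K1)) ** \<Phi> (K - K1) ** C))"
      unfolding left right by (simp add: sum.distrib sum_distrib_left mult.assoc)
    also have "\<dots> \<le> t * Re (trace (cadj K1 ** \<Psi> A ** K1)) + Re (trace (cadj (K - K1) ** (K - K1) ** \<Psi> C))"
      using schwarz_trace_left[OF A, of K1] schwarz_trace_right[OF C, of "K - K1"] t
      by (intro add_mono mult_left_mono) (auto simp: less_eq_complex_def)
    also have "\<dots> = (\<Sum>k\<in>UNIV. t * a' (fst k) * (cmod (f' K1 k))\<^sup>2 + c' (snd k) * (cmod (f' (K - K1) k))\<^sup>2)"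
      unfolding left' right' by (simp add: sum.distrib sum_distrib_left mult.assoc)
    also have "\<dots> = (\<Sum>k\<in>UNIV. parallel_sum (t * a' (fst k)) (c' (snd k)) * (cmod (f' K k))\<^sup>2)"
      unfolding f1 f2 \<theta>_def using t UV'(5,6) by (intro sum.cong parallel_sum_split) auto
    finally show ?thesis .
  qed
  have "Re (trace (cadj (\<Phi> K) ** mat_powr A s ** \<Phi> K ** mat_powr C (1 - s)))
     = (\<Sum>k\<in>UNIV. a (fst k) powr s * c (snd k) powr (1 - s) * (cmod (f (\<Phi> K) k))\<^sup>2)"
    unfolding mat_powr_psd_spectral[OF A] mat_powr_psd_spectral[OF C] trace_weighted_sandwich f_def by simp
  also have "\<dots> \<le> (\<Sum>k\<in>UNIV. a' (fst k) powr s * c' (snd k) powr (1 - s) * (cmod (f' K k))\<^sup>2)"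
    using par UV(5,6) UV'(5,6) by (intro powr_means_le_if_parallel_sums_le s) auto
  also have "\<dots> = Re (trace (cadj K ** mat_powr (\<Psi> A) s ** K ** mat_powr (\<Psi> C) (1 - s)))"
    unfolding mat_powr_psd_spectral[OF A'] mat_powr_psd_spectral[OF C'] trace_weighted_sandwich f'_def by simp
  finally show ?thesis .
qed

end

text \<open>
  The order on \<open>complex\<close> also demands equal imaginary parts; traces of positive semidefinite
  matrices are real.
\<close>

lemma trace_le_iff_Re:
  assumes "psd_spectral A U a" "psd_spectral B V b"
  shows "trace A \<le> trace B \<longleftrightarrow> Re (trace A) \<le> Re (trace B)"
proof -
  have "trace A = complex_of_real (sum a UNIV)" "trace B = complex_of_real (sum b UNIV)"
    using assms trace_unitary_diag by (auto simp: psd_spectral_def)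
  then show ?thesis by (simp add: less_eq_complex_def)
qed

theorem theorem1p9:
  fixes \<Phi> :: "complex^'m^'m \<Rightarrow> complex^'n^'n"
    and A :: "complex^'n^'n" and B :: "complex^'m^'m" and p :: real
  assumes "0 < p" and "p \<le> 1"
    and "schwarz_map \<Phi>" and "unital \<Phi>"
    and "pos_def A"
  shows "trace (mat_powr (cadj (\<Phi> B) ** mat_powr A p ** \<Phi> B) (1 / p))
       \<le> trace (mat_powr (cadj B ** mat_powr (hs_adjoint \<Phi> A) p ** B) (1 / p))"
proof -
  interpret unital_schwarz_map \<Phi> by unfold_locales (fact assms)+
  obtain U a where A: "psd_spectral A U a"
    using pos_semidef_diag[OF pos_def_imp_pos_semidef[OF \<open>pos_def A\<close>]] .
  obtain U' a' where A': "psd_spectral (hs_adjoint \<Phi> A) U' a'" using hs_adjoint_psd_spectral[OF A] .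
  define M where "M = cadj (\<Phi> B) ** mat_powr A p ** \<Phi> B"
  define N where "N = cadj B ** mat_powr (hs_adjoint \<Phi> A) p ** B"
  obtain V \<mu> where M: "psd_spectral M V \<mu>"
    using psd_spectral_congruence[OF psd_spectral_powr[OF A]] unfolding M_def .
  obtain W \<nu> where N: "psd_spectral N W \<nu>"
    using psd_spectral_congruence[OF psd_spectral_powr[OF A']] unfolding N_def .
  have "trace (mat_powr M (1 / p)) \<le> trace (mat_powr N (1 / p))"
  proof (cases "p = 1")
    case True
    then show ?thesis
      using schwarz_trace_left[OF A, of B] mat_powr_1[OF M] mat_powr_1[OF N] mat_powr_1[OF A] mat_powr_1[OF A']
      by (simp add: M_def N_def)
  next
    case False
    then have p: "0 < p" "p < 1" using assms by auto
    \<comment> \<open>This is the choice of \<open>C\<close> for which the pairing of \<open>M\<close> with \<open>C\<^bsup>1-p\<^esup>\<close> has trace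
        \<open>Tr M\<^bsup>1/p\<^esup>\<close>.\<close>
    define C where "C = mat_powr M (1 / p)"
    have C: "psd_spectral C V (\<lambda>i. \<mu> i powr (1 / p))" unfolding C_def by (rule psd_spectral_powr[OF M])
    obtain Y \<delta> where D: "psd_spectral (hs_adjoint \<Phi> C) Y \<delta>" using hs_adjoint_psd_spectral[OF C] .
    have VV: "unitary_mat V" "M = V ** diag_mat \<mu> ** cadj V" "\<And>i. 0 \<le> \<mu> i"
      using M by (auto simp: psd_spectral_def)
    have "M ** mat_powr C (1 - p) = C"
    proof -
      let ?E = "diag_mat (\<lambda>i. (\<mu> i powr (1 / p)) powr (1 - p))"
      have "M ** mat_powr C (1 - p) = V ** (diag_mat \<mu> ** (cadj V ** V) ** ?E) ** cadj V"
        unfolding mat_powr_psd_spectral[OF C] VV(2) by (simp only: matrix_mul_assoc)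
      also have "diag_mat \<mu> ** (cadj V ** V) ** ?E = diag_mat (\<lambda>i. \<mu> i * (\<mu> i powr (1 / p)) powr (1 - p))"
        using VV(1) by (simp add: unitary_mat_def)
          (simp add: vec_eq_iff diag_mat_mult_right, simp add: diag_mat_def)
      also have "(\<lambda>i. \<mu> i * (\<mu> i powr (1 / p)) powr (1 - p)) = (\<lambda>i. \<mu> i powr (1 / p))"
      proof
        fix i
        have "\<mu> i * (\<mu> i powr (1 / p)) powr (1 - p) = \<mu> i powr (1 + 1 / p * (1 - p))"
          using VV(3)[of i] by (cases "\<mu> i = 0") (auto simp: powr_powr powr_add)
        also have "1 + 1 / p * (1 - p) = 1 / p" using p by (simp add: field_simps)
        finally show "\<mu> i * (\<mu> i powr (1 / p)) powr (1 - p) = \<mu> i powr (1 / p)" .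
      qed
      finally show ?thesis using C by (simp add: psd_spectral_def)
    qed
    then have "Re (trace C) = Re (trace (M ** mat_powr C (1 - p)))" by simp
    also have "\<dots> \<le> Re (trace (N ** mat_powr (hs_adjoint \<Phi> C) (1 - p)))"
      unfolding M_def N_def by (rule lieb_functional_monotone[OF p A C])
    also have "\<dots> \<le> p * Re (trace (mat_powr N (1 / p))) + (1 - p) * Re (trace (hs_adjoint \<Phi> C))"
      by (rule trace_mult_powr_le[OF N D p])
    finally have "p * Re (trace C) \<le> p * Re (trace (mat_powr N (1 / p)))"
      by (simp add: trace_hs_adjoint_eq algebra_simps)
    then have "Re (trace C) \<le> Re (trace (mat_powr N (1 / p)))" using p by simp
    then show ?thesis
      unfolding trace_le_iff_Re[OF psd_spectral_powr[OF M] psd_spectral_powr[OF N]] C_def .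
  qed
  then show ?thesis by (simp add: M_def N_def)
qed

end
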